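(* Let $\mathscr{M}$ and $\mathscr{X}$ be Hilbert spaces, let $\mathscr{H}=\mathscr{M}\times\mathscr{X}$, let $v=(m,\xi)\in\mathscr{H}$ with primary parameter $m\in\mathscr{M}$ and auxiliary parameter $\xi\in\mathscr{X}$, and let $\Pi_{\mathscr{M}}:\mathscr{H}\to\mathscr{M}$ be the linear projection operator onto $\mathscr{M}$. For $\mathcal{F}\in\mathcal{L}(\mathscr{H},\mathbb{R}^d)$, $\mathbf{w}\in\{0,1\}^s$ and $\mathbf{d}\in\mathbb{R}^d$, let $v^{\mathcal{F}}_{0|d,w}(\mathbf{w},\mathbf{d})$ and $\mathcal{C}^{\mathcal{F}}_{v|w}(\mathbf{w})$ be the approximate (Bayesian approximation error) posterior mean and covariance of $v$ defined in the context, and let $$\mu^{\mathcal{F}}_{m|d,w}=\mathcal{N}\left(\Pi_{\mathscr{M}}v^{\mathcal{F}}_{0|d,w},\ \mathcal{C}^{\mathcal{F}}_{m|d,w}\right),\qquad \mathcal{C}^{\mathcal{F}}_{m|d,w}(\mathbf{w})=\Pi_{\mathscr{M}}\,\mathcal{C}^{\mathcal{F}}_{v|w}(\mathbf{w})\,\Pi_{\mathscr{M}}^{*},$$ be the approximate marginal posterior of $m$. Then the optimal design for the marginalized problem $$\mathbf{w}^*=\operatorname*{arg\,min}_{\mathbf{w}\in\{0,1\}^s}\operatorname{trace}\left[\mathcal{C}^{\mathcal{F}}_{m|d,w}(\mathbf{w})\right]\quad\text{s.t.}\quad\sum_{i=1}^{s}w_i=k$$ is independent of the linear surrogate $\mathcal{F}$.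 As a consequence, the zero operator may be used as the surrogate $\mathcal{F}$ for the marginalized design problem, yielding the same optimal designs as any other $\mathcal{F}\in\mathcal{L}(\mathscr{H},\mathbb{R}^d)$.
   Context: $\mathcal{L}(\mathscr{H}_1,\mathscr{H}_2)$ denotes the bounded linear operators between Hilbert spaces, and $*$ denotes the adjoint. The parameter $v\in\mathscr{H}$ has prior measure $\mu_v$ with mean $v_0$ and strictly positive, self-adjoint, trace-class covariance operator $\mathcal{C}_{vv}$. The data model is $\mathbf{d}(\mathbf{w})=\mathbf{W}(\mathcal{G}(v)+\mathbf{e})$, where $\mathcal{G}:\mathscr{H}\to\mathbb{R}^d$ is a bounded map and $\mathbf{e}\sim\mathcal{N}(\mathbf{e}_0,\boldsymbol{\Gamma}_e)$ is independent of $v$, with $\boldsymbol{\Gamma}_e$ symmetric positive definite. Selection matrix: there are $s$ candidate sensors, each measuring at $\tau\in\mathbb{N}$ times, so $d=\tau s$. For $\mathbf{w}\in\{0,1\}^s$ with $k=\sum_i w_i$ and $r=k\tau$, the matrix $\mathbf{W}=\mathbf{W}(\mathbf{w})\in\{0,1\}^{r\times d}$ is block-diagonal with $\tau$ diagonal blocks, each equal to $\mathbf{P}_{\mathbf{w}}\in\{0,1\}^{k\times s}$, the submatrix of $\operatorname{diag}(\mathbf{w})$ obtained by removing the rows corresponding to zero weights. Outer product and cross-covariance: $(u\otimes w)z=\langle w,z\rangle u$, and $\mathcal{C}_{uw}=\mathbb{E}[(u-u_0)\otimes(w-w_0)]=\mathcal{C}_{wu}^*$. For a given $\mathcal{F}$,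 the approximation error is $\boldsymbol{\varepsilon}=\mathcal{G}(v)-\mathcal{F}v$ with $v\sim\mu_v$, with mean $\boldsymbol{\varepsilon}_0$, covariance matrix $\boldsymbol{\Gamma}_{\varepsilon\varepsilon}$ and cross-covariances $\mathcal{C}_{\varepsilon v}$, $\mathcal{C}_{v\varepsilon}=\mathcal{C}_{\varepsilon v}^*$. Set $$\widetilde{\mathcal{F}}=\mathcal{F}+\mathcal{C}_{\varepsilon v}\mathcal{C}_{vv}^{-1}\in\mathcal{L}(\mathscr{H},\mathbb{R}^d),\quad \widetilde{\mathbf{d}}=\mathbf{d}-\mathbf{e}_0-\boldsymbol{\varepsilon}_0+\mathcal{C}_{\varepsilon v}\mathcal{C}_{vv}^{-1}v_0,\quad \boldsymbol{\Gamma}_{\eta|v}=\boldsymbol{\Gamma}_e+\boldsymbol{\Gamma}_{\varepsilon\varepsilon}-\mathcal{C}_{\varepsilon v}\mathcal{C}_{vv}^{-1}\mathcal{C}_{v\varepsilon}.$$ The approximate posterior covariance and mean of $v$ are $$\mathcal{C}^{\mathcal{F}}_{v|w}(\mathbf{w})=\left(\mathcal{C}_{vv}^{-1}+\widetilde{\mathcal{F}}^{*}\mathbf{W}^T(\mathbf{W}\boldsymbol{\Gamma}_{\eta|v}\mathbf{W}^T)^{-1}\mathbf{W}\widetilde{\mathcal{F}}\right)^{-1},$$ $$v^{\mathcal{F}}_{0|d,w}(\mathbf{w},\mathbf{d})=\mathcal{C}^{\mathcal{F}}_{v|w}(\mathbf{w})\left(\widetilde{\mathcal{F}}^{*}\mathbf{W}^T(\mathbf{W}\boldsymbol{\Gamma}_{\eta|v}\mathbf{W}^T)^{-1}\mathbf{W}\widetilde{\mathbf{d}}+\mathcal{C}_{vv}^{-1}v_0\right).$$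 "Independent of the surrogate" means that the set of minimizers is the same for all $\mathcal{F}\in\mathcal{L}(\mathscr{H},\mathbb{R}^d)$, each used with its own approximation-error statistics. *)

theory Defs
  imports
    "HOL-Probability.Probability"
    "Jordan_Normal_Form.DL_Submatrix"
    "Jordan_Normal_Form.Gauss_Jordan_Elimination"
begin

(* Both HOL-Analysis and Jordan_Normal_Form use $ for vector entries, and HOL-Algebra overlays
   the syntax of inv; entries and inverses are therefore written in prefix form below. *)

section \<open>Operators on real Hilbert spaces\<close>

definition orthonormal_basis :: "'a::real_inner set \<Rightarrow> bool" where
  "orthonormal_basis B \<longleftrightarrow>
     pairwise Linear_Algebra.orthogonal B \<and> (\<forall>b\<in>B. norm b = 1) \<and> closure (span B) = UNIV"

definition op_trace :: "('a::real_inner \<Rightarrow> 'a) \<Rightarrow> real" where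
  "op_trace A =
     (THE t. \<forall>B. orthonormal_basis B \<longrightarrow> ((\<lambda>b. inner (A b) b) has_sum t) B)"

definition self_adjoint :: "('a::real_inner \<Rightarrow> 'a) \<Rightarrow> bool" where
  "self_adjoint A \<longleftrightarrow> (\<forall>x y. inner (A x) y = inner x (A y))"

definition strictly_positive :: "('a::real_inner \<Rightarrow> 'a) \<Rightarrow> bool" where
  "strictly_positive A \<longleftrightarrow> (\<forall>x. x \<noteq> 0 \<longrightarrow> 0 < inner (A x) x)"

(* Only meant for positive self-adjoint A, where |A| = A. *)
definition trace_class_pos :: "('a::real_inner \<Rightarrow> 'a) \<Rightarrow> bool" where
  "trace_class_pos A \<longleftrightarrow>
     bounded_linear A \<and>
     (\<forall>B. orthonormal_basis B \<longrightarrow> (\<lambda>b. inner (A b) b) summable_on B)"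

(* For an injective C with dense range, the inverse of C is in general unbounded and has domain
   range C; a product of an operator A with the inverse of C is read as the bounded operator on
   the whole space that extends it. *)
definition extends_comp_inv ::
  "('a::real_normed_vector \<Rightarrow>\<^sub>L 'b::real_normed_vector) \<Rightarrow> ('a \<Rightarrow> 'b) \<Rightarrow> ('a \<Rightarrow> 'a) \<Rightarrow> bool" where
  "extends_comp_inv T A C \<longleftrightarrow> (\<forall>x\<in>range C. blinfun_apply T x = A (inv_into UNIV C x))"

definition comp_inv ::
  "('a::real_normed_vector \<Rightarrow> 'b::real_normed_vector) \<Rightarrow> ('a \<Rightarrow> 'a) \<Rightarrow> ('a \<Rightarrow>\<^sub>L 'b)" where
  "comp_inv A C = (THE T. extends_comp_inv T A C)"

section \<open>Covariance operators and Gaussian measures\<close>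

definition outer :: "'b::real_vector \<Rightarrow> 'a::real_inner \<Rightarrow> 'a \<Rightarrow> 'b" where
  "outer u w = (\<lambda>z. inner w z *\<^sub>R u)"

(* The expectation of the operator-valued integrand is taken pointwise (strong sense). *)
definition cross_cov ::
  "'c measure \<Rightarrow> ('c \<Rightarrow> 'b::{real_inner,banach,second_countable_topology}) \<Rightarrow>
     ('c \<Rightarrow> 'a::{real_inner,banach,second_countable_topology}) \<Rightarrow> 'a \<Rightarrow> 'b" where
  "cross_cov M u w =
     (\<lambda>z. \<integral>x. outer (u x - (\<integral>y. u y \<partial>M)) (w x - (\<integral>y. w y \<partial>M)) z \<partial>M)"

(* Via the characteristic functional, so that degenerate Gaussians are covered as well. *)
definition is_gaussian :: "'a::real_inner measure \<Rightarrow> 'a \<Rightarrow> ('a \<Rightarrow> 'a) \<Rightarrow> bool" where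
  "is_gaussian N a C \<longleftrightarrow>
     prob_space N \<and> sets N = sets borel \<and>
     (\<forall>h. (\<integral>x. iexp (inner x h) \<partial>N) =
          iexp (inner a h) * complex_of_real (exp (- (inner (C h) h / 2))))"

definition gaussian :: "'a::real_inner \<Rightarrow> ('a \<Rightarrow> 'a) \<Rightarrow> 'a measure" where
  "gaussian a C = (THE N. is_gaussian N a C)"

section \<open>Designs and selection matrices\<close>

definition designs :: "nat \<Rightarrow> nat \<Rightarrow> real Matrix.vec set" where
  "designs s k = {w \<in> carrier_vec s.
     (\<forall>i<s. vec_index w i \<in> {0, 1}) \<and> (\<Sum>i<s. vec_index w i) = real k}"

definition selection_block :: "nat \<Rightarrow> real Matrix.vec \<Rightarrow> real mat" where
  "selection_block s w = submatrix (mat_diag s (vec_index w)) {i. i < s \<and> vec_index w i \<noteq> 0} UNIV"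

definition selection_matrix :: "nat \<Rightarrow> nat \<Rightarrow> real Matrix.vec \<Rightarrow> real mat" where
  "selection_matrix \<tau> s w = diag_block_mat (replicate \<tau> (selection_block s w))"

(* The data space is real ^ 'd; num :: nat => 'd numbers its n coordinates, which translates
   between it and the matrices and vectors of Jordan_Normal_Form, whose sizes may depend on w.
   For n = \<tau> * s, coordinate t * s + i is the measurement of sensor i at time t. *)
definition coord_vec :: "(nat \<Rightarrow> 'd::finite) \<Rightarrow> nat \<Rightarrow> real ^ 'd \<Rightarrow> real Matrix.vec" where
  "coord_vec num n y = Matrix.vec n (\<lambda>p. vec_nth y (num p))"

definition coord_mat ::
  "(nat \<Rightarrow> 'd::finite) \<Rightarrow> nat \<Rightarrow> (real ^ 'd \<Rightarrow> real ^ 'd) \<Rightarrow> real mat" where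
  "coord_mat num n A = Matrix.mat n n (\<lambda>(p, q). vec_nth (A (axis (num q) 1)) (num p))"

definition mat_op ::
  "(nat \<Rightarrow> 'd::finite) \<Rightarrow> nat \<Rightarrow> real mat \<Rightarrow> real ^ 'd \<Rightarrow> real ^ 'd" where
  "mat_op num n B =
     (\<lambda>y. \<chi> j. vec_index (mult_mat_vec B (coord_vec num n y)) (inv_into {..<n} num j))"

(* The operator W^T (W Gamma W^T)^(-1) W on the data space. *)
definition data_precision ::
  "(nat \<Rightarrow> 'd::finite) \<Rightarrow> nat \<Rightarrow> nat \<Rightarrow> (real ^ 'd \<Rightarrow> real ^ 'd) \<Rightarrow> real Matrix.vec \<Rightarrow>
     real ^ 'd \<Rightarrow> real ^ 'd" where
  "data_precision num \<tau> s \<Gamma> w =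
     (let W = selection_matrix \<tau> s w; Wt = transpose_mat W
      in mat_op num (\<tau> * s)
           (Wt * the (mat_inverse (W * coord_mat num (\<tau> * s) \<Gamma> * Wt)) * W))"

section \<open>Bayesian approximation error\<close>

definition prior_mean :: "'h::{real_inner,banach,second_countable_topology} measure \<Rightarrow> 'h" where
  "prior_mean \<mu> = (\<integral>v. v \<partial>\<mu>)"

definition prior_cov :: "'h::{real_inner,banach,second_countable_topology} measure \<Rightarrow> 'h \<Rightarrow> 'h" where
  "prior_cov \<mu> = cross_cov \<mu> (\<lambda>v. v) (\<lambda>v. v)"

definition approx_error ::
  "('h::real_normed_vector \<Rightarrow> real ^ 'd::finite) \<Rightarrow> ('h \<Rightarrow>\<^sub>L (real ^ 'd)) \<Rightarrow> 'h \<Rightarrow> real ^ 'd" where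
  "approx_error G F = (\<lambda>v. G v - blinfun_apply F v)"

definition error_mean ::
  "'h::{real_inner,banach,second_countable_topology} measure \<Rightarrow> ('h \<Rightarrow> real ^ 'd::finite) \<Rightarrow>
     ('h \<Rightarrow>\<^sub>L (real ^ 'd)) \<Rightarrow> real ^ 'd" where
  "error_mean \<mu> G F = (\<integral>v. approx_error G F v \<partial>\<mu>)"

definition error_cov ::
  "'h::{real_inner,banach,second_countable_topology} measure \<Rightarrow> ('h \<Rightarrow> real ^ 'd::finite) \<Rightarrow>
     ('h \<Rightarrow>\<^sub>L (real ^ 'd)) \<Rightarrow> real ^ 'd \<Rightarrow> real ^ 'd" where
  "error_cov \<mu> G F = cross_cov \<mu> (approx_error G F) (approx_error G F)"

definition error_param_cov ::
  "'h::{real_inner,banach,second_countable_topology} measure \<Rightarrow> ('h \<Rightarrow> real ^ 'd::finite) \<Rightarrow>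
     ('h \<Rightarrow>\<^sub>L (real ^ 'd)) \<Rightarrow> 'h \<Rightarrow> real ^ 'd" where
  "error_param_cov \<mu> G F = cross_cov \<mu> (approx_error G F) (\<lambda>v. v)"

definition corrected_surrogate ::
  "'h::{real_inner,banach,second_countable_topology} measure \<Rightarrow> ('h \<Rightarrow> real ^ 'd::finite) \<Rightarrow>
     ('h \<Rightarrow>\<^sub>L (real ^ 'd)) \<Rightarrow> ('h \<Rightarrow>\<^sub>L (real ^ 'd))" where
  "corrected_surrogate \<mu> G F = F + comp_inv (error_param_cov \<mu> G F) (prior_cov \<mu>)"

definition corrected_data ::
  "'h::{real_inner,banach,second_countable_topology} measure \<Rightarrow> ('h \<Rightarrow> real ^ 'd::finite) \<Rightarrow>
     real ^ 'd \<Rightarrow> ('h \<Rightarrow>\<^sub>L (real ^ 'd)) \<Rightarrow> real ^ 'd \<Rightarrow> real ^ 'd" where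
  "corrected_data \<mu> G e\<^sub>0 F d =
     d - e\<^sub>0 - error_mean \<mu> G F
       + blinfun_apply (comp_inv (error_param_cov \<mu> G F) (prior_cov \<mu>)) (prior_mean \<mu>)"

definition total_error_cov ::
  "'h::{real_inner,banach,second_countable_topology} measure \<Rightarrow> ('h \<Rightarrow> real ^ 'd::finite) \<Rightarrow>
     real ^ 'd ^ 'd \<Rightarrow> ('h \<Rightarrow>\<^sub>L (real ^ 'd)) \<Rightarrow> real ^ 'd \<Rightarrow> real ^ 'd" where
  "total_error_cov \<mu> G \<Gamma>\<^sub>e F =
     (\<lambda>y. \<Gamma>\<^sub>e *v y + error_cov \<mu> G F y
        - blinfun_apply (comp_inv (error_param_cov \<mu> G F) (prior_cov \<mu>))
            (adjoint (error_param_cov \<mu> G F) y))"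

(* The inverse of an operator sum with domain range (prior_cov \<mu>). *)
definition posterior_cov ::
  "'h::{real_inner,banach,second_countable_topology} measure \<Rightarrow> ('h \<Rightarrow> real ^ 'd::finite) \<Rightarrow>
     real ^ 'd ^ 'd \<Rightarrow> (nat \<Rightarrow> 'd) \<Rightarrow> nat \<Rightarrow> nat \<Rightarrow> ('h \<Rightarrow>\<^sub>L (real ^ 'd)) \<Rightarrow>
     real Matrix.vec \<Rightarrow> 'h \<Rightarrow> 'h" where
  "posterior_cov \<mu> G \<Gamma>\<^sub>e num \<tau> s F w =
     (let C = prior_cov \<mu>;
          Ft = blinfun_apply (corrected_surrogate \<mu> G F);
          N = data_precision num \<tau> s (total_error_cov \<mu> G \<Gamma>\<^sub>e F) w
      in inv_into (range C) (\<lambda>x. inv_into UNIV C x + adjoint Ft (N (Ft x))))"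

(* The summand C_post C_vv^(-1) v_0 is read through comp_inv, since v_0 need not lie in the
   range of C_vv. *)
definition posterior_mean ::
  "'h::{real_inner,banach,second_countable_topology} measure \<Rightarrow> ('h \<Rightarrow> real ^ 'd::finite) \<Rightarrow>
     real ^ 'd \<Rightarrow> real ^ 'd ^ 'd \<Rightarrow> (nat \<Rightarrow> 'd) \<Rightarrow> nat \<Rightarrow> nat \<Rightarrow> ('h \<Rightarrow>\<^sub>L (real ^ 'd)) \<Rightarrow>
     real Matrix.vec \<Rightarrow> real ^ 'd \<Rightarrow> 'h" where
  "posterior_mean \<mu> G e\<^sub>0 \<Gamma>\<^sub>e num \<tau> s F w d =
     (let Cpost = posterior_cov \<mu> G \<Gamma>\<^sub>e num \<tau> s F w;
          Ft = blinfun_apply (corrected_surrogate \<mu> G F);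
          N = data_precision num \<tau> s (total_error_cov \<mu> G \<Gamma>\<^sub>e F) w
      in Cpost (adjoint Ft (N (corrected_data \<mu> G e\<^sub>0 F d)))
           + blinfun_apply (comp_inv Cpost (prior_cov \<mu>)) (prior_mean \<mu>))"

section \<open>The marginalized design problem\<close>

(* The projection onto the primary parameter is fst. *)
definition marginal_cov ::
  "('m::{real_inner,banach,second_countable_topology} \<times>
    'x::{real_inner,banach,second_countable_topology}) measure \<Rightarrow>
     ('m \<times> 'x \<Rightarrow> real ^ 'd::finite) \<Rightarrow> real ^ 'd ^ 'd \<Rightarrow> (nat \<Rightarrow> 'd) \<Rightarrow> nat \<Rightarrow> nat \<Rightarrow>
     (('m \<times> 'x) \<Rightarrow>\<^sub>L (real ^ 'd)) \<Rightarrow> real Matrix.vec \<Rightarrow> 'm \<Rightarrow> 'm" where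
  "marginal_cov \<mu> G \<Gamma>\<^sub>e num \<tau> s F w =
     fst \<circ> posterior_cov \<mu> G \<Gamma>\<^sub>e num \<tau> s F w \<circ> adjoint fst"

definition marginal_posterior ::
  "('m::{real_inner,banach,second_countable_topology} \<times>
    'x::{real_inner,banach,second_countable_topology}) measure \<Rightarrow>
     ('m \<times> 'x \<Rightarrow> real ^ 'd::finite) \<Rightarrow> real ^ 'd \<Rightarrow> real ^ 'd ^ 'd \<Rightarrow> (nat \<Rightarrow> 'd) \<Rightarrow> nat \<Rightarrow> nat \<Rightarrow>
     (('m \<times> 'x) \<Rightarrow>\<^sub>L (real ^ 'd)) \<Rightarrow> real Matrix.vec \<Rightarrow> real ^ 'd \<Rightarrow> 'm measure" where
  "marginal_posterior \<mu> G e\<^sub>0 \<Gamma>\<^sub>e num \<tau> s F w d =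
     gaussian (fst (posterior_mean \<mu> G e\<^sub>0 \<Gamma>\<^sub>e num \<tau> s F w d))
       (marginal_cov \<mu> G \<Gamma>\<^sub>e num \<tau> s F w)"

definition optimal_designs ::
  "('m::{real_inner,banach,second_countable_topology} \<times>
    'x::{real_inner,banach,second_countable_topology}) measure \<Rightarrow>
     ('m \<times> 'x \<Rightarrow> real ^ 'd::finite) \<Rightarrow> real ^ 'd ^ 'd \<Rightarrow> (nat \<Rightarrow> 'd) \<Rightarrow> nat \<Rightarrow> nat \<Rightarrow> nat \<Rightarrow>
     (('m \<times> 'x) \<Rightarrow>\<^sub>L (real ^ 'd)) \<Rightarrow> real Matrix.vec set" where
  "optimal_designs \<mu> G \<Gamma>\<^sub>e num \<tau> s k F =
     {w. is_arg_min (\<lambda>w. op_trace (marginal_cov \<mu> G \<Gamma>\<^sub>e num \<tau> s F w)) (\<lambda>w. w \<in> designs s k) w}"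

end

theory Submission
  imports Defs
begin

text \<open>
  The posterior covariance depends on the surrogate \<open>F\<close> only through the corrected surrogate
  \<open>F + C\<^sub>\<epsilon>\<^sub>v C\<^sup>-\<^sup>1\<close> and the error covariance \<open>\<Gamma>\<^sub>e + \<Gamma>\<^sub>\<epsilon>\<^sub>\<epsilon> - C\<^sub>\<epsilon>\<^sub>v C\<^sup>-\<^sup>1 C\<^sub>v\<^sub>\<epsilon>\<close>, where \<open>C\<close> is the prior
  covariance. Neither of them changes with \<open>F\<close>, so the design objectives themselves, and not only
  their minimizers, coincide.

  The error is \<open>\<epsilon> = G v - F v\<close>, and a cross-covariance is bilinear in its two random vectors, so
  \<open>C\<^sub>\<epsilon>\<^sub>v = C\<^sub>G\<^sub>v - F C\<close>. Hence \<open>C\<^sub>\<epsilon>\<^sub>v C\<^sup>-\<^sup>1 = T - F\<close> with \<open>T = C\<^sub>G\<^sub>v C\<^sup>-\<^sup>1\<close>, and the corrected surrogate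
  is \<open>T\<close>, the best linear predictor of \<open>G v\<close>. Expanding by bilinearity,
  \<open>\<Gamma>\<^sub>\<epsilon>\<^sub>\<epsilon> = \<Gamma>\<^sub>G\<^sub>G - F C\<^sub>v\<^sub>G - C\<^sub>G\<^sub>v F\<^sup>* + F C F\<^sup>*\<close> and
  \<open>(T - F) (C\<^sub>v\<^sub>G - C F\<^sup>*) = T C\<^sub>v\<^sub>G - F C\<^sub>v\<^sub>G - T C F\<^sup>* + F C F\<^sup>*\<close>. Since \<open>T C = C\<^sub>G\<^sub>v\<close>, the difference is
  \<open>\<Gamma>\<^sub>G\<^sub>G - T C\<^sub>v\<^sub>G\<close>: the covariance of the part of \<open>G v\<close> that \<open>v\<close> does not predict linearly, which
  does not involve \<open>F\<close>.

  Two points need the completeness of the parameter space, in the form of the Riesz representation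
  theorem (\<open>riesz_representation\<close>): the existence of \<open>F\<^sup>*\<close>, and the fact that a bounded operator is
  determined by its values on the range of \<open>C\<close> (\<open>extends_comp_inv_unique\<close>), without which
  \<open>C\<^sub>\<epsilon>\<^sub>v C\<^sup>-\<^sup>1\<close> would not be a well-defined operator.
\<close>

section \<open>Riesz representation and adjoints\<close>

text \<open>
  The representing vector minimizes \<open>J x = (norm x)\<^sup>2 - 2 h x\<close>. Minimizing sequences are Cauchy by
  the parallelogram law, and the first-order condition at the minimum is the representation.
\<close>
lemma riesz_representation:
  fixes h :: "'a::{real_inner,banach} \<Rightarrow> real"
  assumes "bounded_linear h"
  obtains z where "\<And>x. h x = inner x z"
proof -
  interpret h: bounded_linear h by fact
  define J where "J x = (norm x)\<^sup>2 - 2 * h x" for x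
  define d where "d = Inf (range J)"
  obtain K where K: "\<And>x. norm (h x) \<le> norm x * K"
    using h.bounded by blast
  have "J x \<ge> - K\<^sup>2" for x
  proof -
    have "0 \<le> (norm x - K)\<^sup>2" by simp
    moreover have "h x \<le> norm x * K" using K[of x] by simp
    ultimately show ?thesis unfolding J_def power2_diff by linarith
  qed
  then have bdd: "bdd_below (range J)" by (auto intro!: bdd_belowI)
  have d_le: "d \<le> J x" for x unfolding d_def by (rule cInf_lower[OF _ bdd]) simp
  have dist_le: "(norm (x - y))\<^sup>2 \<le> 2 * J x + 2 * J y - 4 * d" for x y
  proof -
    define m where "m = (1/2) *\<^sub>R (x + y)"
    have "(norm (x - y))\<^sup>2 = 2 * J x + 2 * J y - 4 * J m"
      unfolding J_def m_def power2_norm_eq_inner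
      by (simp add: h.scaleR h.add inner_diff_left inner_diff_right inner_add_left inner_add_right
          inner_commute[of y x] algebra_simps)
    then show ?thesis using d_le[of m] by (simp add: algebra_simps)
  qed
  have "\<exists>x. J x < d + inverse (real (Suc n))" for n
  proof -
    have "Inf (range J) < d + inverse (real (Suc n))"
      unfolding d_def by simp
    then show ?thesis using cInf_lessD[of "range J"] by auto
  qed
  then obtain X where X: "\<And>n. J (X n) < d + inverse (real (Suc n))" by metis
  have "Cauchy X"
  proof (rule metric_CauchyI)
    fix r :: real assume "r > 0"
    then obtain N where N: "inverse (real (Suc N)) < r\<^sup>2 / 4"
      using reals_Archimedean[of "r\<^sup>2 / 4"] by auto
    have close: "J (X n) - d < r\<^sup>2 / 4" if "n \<ge> N" for n
    proof -
      have "inverse (real (Suc n)) \<le> inverse (real (Suc N))"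
        using that by (simp add: field_simps)
      then show ?thesis using X[of n] N by linarith
    qed
    have "dist (X m) (X n) < r" if "m \<ge> N" "n \<ge> N" for m n
    proof -
      have "(dist (X m) (X n))\<^sup>2 < r\<^sup>2"
        using dist_le[of "X m" "X n"] close[OF that(1)] close[OF that(2)]
        by (simp add: dist_norm)
      then show ?thesis using \<open>r > 0\<close> by (simp add: power_less_imp_less_base)
    qed
    then show "\<exists>M. \<forall>m\<ge>M. \<forall>n\<ge>M. dist (X m) (X n) < r" by blast
  qed
  then obtain z where z: "X \<longlonglongrightarrow> z"
    using Cauchy_convergent convergent_def by blast
  have "(\<lambda>n. J (X n)) \<longlonglongrightarrow> J z"
    unfolding J_def by (intro tendsto_intros h.tendsto z)
  moreover have "(\<lambda>n. d + inverse (real (Suc n))) \<longlonglongrightarrow> d + 0"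
    by (intro tendsto_intros LIMSEQ_inverse_real_of_nat)
  ultimately have "J z \<le> d + 0"
    by (rule LIMSEQ_le) (use X less_imp_le in blast)
  then have min: "J z \<le> J x" for x using d_le[of x] by linarith
  have "h x = inner x z" for x
  proof (cases "x = 0")
    case False
    define c where "c = inner x z - h x"
    define t where "t = - c / (norm x)\<^sup>2"
    have "J (z + t *\<^sub>R x) = J z + t\<^sup>2 * (norm x)\<^sup>2 + 2 * t * c"
      unfolding J_def c_def power2_norm_eq_inner
      by (simp add: h.scaleR h.add inner_add_left inner_add_right inner_commute[of z x]
          algebra_simps power2_eq_square)
    moreover have "t\<^sup>2 * (norm x)\<^sup>2 = c\<^sup>2 / (norm x)\<^sup>2" "2 * t * c = - 2 * (c\<^sup>2 / (norm x)\<^sup>2)"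
      using False unfolding t_def by (simp_all add: field_simps power2_eq_square)
    ultimately have "c\<^sup>2 / (norm x)\<^sup>2 \<le> 0" using min[of "z + t *\<^sub>R x"] by linarith
    then have "c = 0" using False by (simp add: divide_le_0_iff)
    then show ?thesis by (simp add: c_def)
  qed (simp add: h.zero)
  then show thesis by (rule that)
qed

lemma bounded_linear_adjoint_works:
  fixes F :: "'a::{real_inner,banach} \<Rightarrow> 'b::real_inner"
  assumes "bounded_linear F"
  shows "inner (F x) y = inner x (adjoint F y)"
proof -
  have "\<exists>z. \<forall>x. inner (F x) y = inner x z" for y
    using riesz_representation[OF bounded_linear_inner_left_comp[OF assms, of y]] by blast
  then have "\<exists>f'. \<forall>x y. inner (F x) y = inner x (f' y)" by metis
  then show ?thesis unfolding adjoint_def by (rule someI2_ex) blast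
qed

lemma strictly_positive_inj:
  assumes "bounded_linear C" "strictly_positive C"
  shows "inj C"
proof -
  interpret bounded_linear C by fact
  show ?thesis
    unfolding inj_iff_eq_0 using assms(2)
    by (metis inner_zero_left less_irrefl strictly_positive_def)
qed

text \<open>
  A strictly positive operator has dense range: a vector orthogonal to the range is orthogonal to
  its own image, hence zero. If \<open>T - S\<close> vanishes on the range of \<open>C\<close>, this applies to every
  \<open>(T - S)\<^sup>* y\<close>.
\<close>
lemma extends_comp_inv_unique:
  fixes C :: "'a::{real_inner,banach} \<Rightarrow> 'a" and T S :: "'a \<Rightarrow>\<^sub>L 'b::real_inner"
  assumes "strictly_positive C" "extends_comp_inv T A C" "extends_comp_inv S A C"
  shows "T = S"
proof (rule blinfun_eqI)
  fix x
  define D where "D = T - S"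
  have adj: "inner (D a) y = inner a (adjoint D y)" for a y
    by (rule bounded_linear_adjoint_works) (rule blinfun.bounded_linear_right)
  have "adjoint D y = 0" for y
  proof (rule ccontr)
    assume nz: "adjoint D y \<noteq> 0"
    have "D (C (adjoint D y)) = 0"
      using assms(2,3) by (simp add: D_def extends_comp_inv_def blinfun.diff_left)
    then have "inner (C (adjoint D y)) (adjoint D y) = 0"
      by (metis adj inner_zero_left)
    moreover have "0 < inner (C (adjoint D y)) (adjoint D y)"
      using nz assms(1) unfolding strictly_positive_def by blast
    ultimately show False by simp
  qed
  then have "inner (D x) (D x) = 0" by (simp add: adj)
  then show "T x = S x" by (simp add: D_def blinfun.diff_left)
qed

lemma comp_inv_eqI:
  fixes C :: "'a::{real_inner,banach} \<Rightarrow> 'a" and T :: "'a \<Rightarrow>\<^sub>L 'b::real_inner"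
  assumes "strictly_positive C" "extends_comp_inv T A C"
  shows "comp_inv A C = T"
  unfolding comp_inv_def using assms extends_comp_inv_unique by (intro the_equality) blast+

section \<open>Cross-covariances of square-integrable random vectors\<close>

definition sq_integrable :: "'c measure \<Rightarrow> ('c \<Rightarrow> 'b::real_normed_vector) \<Rightarrow> bool" where
  "sq_integrable M u \<longleftrightarrow> u \<in> borel_measurable M \<and> integrable M (\<lambda>x. (norm (u x))\<^sup>2)"

lemma sq_integrable_blinfun:
  fixes F :: "'a::real_normed_vector \<Rightarrow>\<^sub>L 'b::real_normed_vector"
  assumes "sq_integrable M u"
  shows "sq_integrable M (\<lambda>x. F (u x))"
  unfolding sq_integrable_def
proof
  have u: "u \<in> borel_measurable M" using assms by (simp add: sq_integrable_def)
  have "blinfun_apply F \<in> borel_measurable borel"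
    by (intro borel_measurable_continuous_onI linear_continuous_on blinfun.bounded_linear_right)
  with u show meas: "(\<lambda>x. F (u x)) \<in> borel_measurable M"
    by (rule measurable_compose)
  show "integrable M (\<lambda>x. (norm (F (u x)))\<^sup>2)"
  proof (rule Bochner_Integration.integrable_bound)
    show "integrable M (\<lambda>x. (norm F)\<^sup>2 * (norm (u x))\<^sup>2)"
      using assms by (simp add: sq_integrable_def)
    show "(\<lambda>x. (norm (F (u x)))\<^sup>2) \<in> borel_measurable M"
      using meas by measurable
    show "AE x in M. norm ((norm (F (u x)))\<^sup>2) \<le> norm ((norm F)\<^sup>2 * (norm (u x))\<^sup>2)"
      using power_mono[OF norm_blinfun norm_ge_zero, of F _ 2]
      by (intro AE_I2) (simp add: power_mult_distrib)
  qed
qed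

lemma sq_integrable_diff:
  fixes u w :: "'c \<Rightarrow> 'b::{real_inner,second_countable_topology}"
  assumes "sq_integrable M u" "sq_integrable M w"
  shows "sq_integrable M (\<lambda>x. u x - w x)"
  unfolding sq_integrable_def
proof
  have [measurable]: "u \<in> borel_measurable M" "w \<in> borel_measurable M"
    using assms by (simp_all add: sq_integrable_def)
  show "(\<lambda>x. u x - w x) \<in> borel_measurable M" by measurable
  have bound: "(norm (a - b))\<^sup>2 \<le> 2 * (norm a)\<^sup>2 + 2 * (norm b)\<^sup>2" for a b :: 'b
  proof -
    have "0 \<le> (norm (a + b))\<^sup>2" by simp
    then show ?thesis
      unfolding power2_norm_eq_inner
      by (simp add: inner_diff_left inner_diff_right inner_add_left inner_add_right inner_commute)
  qed
  show "integrable M (\<lambda>x. (norm (u x - w x))\<^sup>2)"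
    by (rule Bochner_Integration.integrable_bound
          [where f = "\<lambda>x. 2 * (norm (u x))\<^sup>2 + 2 * (norm (w x))\<^sup>2"])
       (use assms bound in \<open>auto simp: sq_integrable_def\<close>)
qed

lemma integrable_outer:
  fixes u :: "'c \<Rightarrow> 'b::{real_inner,banach,second_countable_topology}"
    and w :: "'c \<Rightarrow> 'a::{real_inner,banach,second_countable_topology}"
  assumes "sq_integrable M u" "sq_integrable M w"
  shows "integrable M (\<lambda>x. outer (u x) (w x) z)"
proof (rule Bochner_Integration.integrable_bound)
  have [measurable]: "u \<in> borel_measurable M" "w \<in> borel_measurable M"
    using assms by (simp_all add: sq_integrable_def)
  show "integrable M (\<lambda>x. norm z * ((norm (u x))\<^sup>2 + (norm (w x))\<^sup>2))"
    using assms by (auto simp: sq_integrable_def)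
  show "(\<lambda>x. outer (u x) (w x) z) \<in> borel_measurable M"
    unfolding outer_def by measurable
  have "norm (outer a b z) \<le> norm z * ((norm a)\<^sup>2 + (norm b)\<^sup>2)" for a :: 'b and b
  proof -
    have "\<bar>inner b z\<bar> * norm a \<le> (norm b * norm z) * norm a"
      by (intro mult_right_mono Cauchy_Schwarz_ineq2) simp
    also have "\<dots> = norm z * (norm a * norm b)" by simp
    also have "norm a * norm b \<le> (norm a)\<^sup>2 + (norm b)\<^sup>2"
      using sum_squares_bound[of "norm a" "norm b"] zero_le_power2[of "norm a"]
        zero_le_power2[of "norm b"] mult_nonneg_nonneg[of "norm a" "norm b"] by linarith
    finally show ?thesis by (simp add: outer_def mult_left_mono)
  qed
  then show "AE x in M. norm (outer (u x) (w x) z)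
               \<le> norm (norm z * ((norm (u x))\<^sup>2 + (norm (w x))\<^sup>2))"
    by (intro AE_I2) (simp add: order_trans[OF _ abs_ge_self])
qed

context prob_space
begin

lemma sq_integrable_integrable:
  fixes u :: "'a \<Rightarrow> 'b::{real_inner,banach,second_countable_topology}"
  assumes "sq_integrable M u"
  shows "integrable M u"
proof (rule Bochner_Integration.integrable_bound)
  show "integrable M (\<lambda>x. 1 + (norm (u x))\<^sup>2)" "u \<in> borel_measurable M"
    using assms by (simp_all add: sq_integrable_def)
  have "norm a \<le> 1 + (norm a)\<^sup>2" for a :: 'b
  proof -
    have "2 * norm a \<le> 1 + (norm a)\<^sup>2" using sum_squares_bound[of "norm a" 1] by simp
    then show ?thesis using norm_ge_zero[of a] by linarith
  qed
  then show "AE x in M. norm (u x) \<le> norm (1 + (norm (u x))\<^sup>2)" by auto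
qed

lemma sq_integrable_centred:
  fixes u :: "'a \<Rightarrow> 'b::{real_inner,banach,second_countable_topology}"
  assumes "sq_integrable M u"
  shows "sq_integrable M (\<lambda>x. u x - expectation u)"
  by (intro sq_integrable_diff assms) (simp add: sq_integrable_def)

lemma cross_cov_diff_left:
  fixes u u' :: "'a \<Rightarrow> 'b::{real_inner,banach,second_countable_topology}"
    and w :: "'a \<Rightarrow> 'c::{real_inner,banach,second_countable_topology}"
  assumes "sq_integrable M u" "sq_integrable M u'" "sq_integrable M w"
  shows "cross_cov M (\<lambda>x. u x - u' x) w z = cross_cov M u w z - cross_cov M u' w z"
proof -
  have "cross_cov M (\<lambda>x. u x - u' x) w z =
      (\<integral>x. outer (u x - expectation u) (w x - expectation w) z -
            outer (u' x - expectation u') (w x - expectation w) z \<partial>M)"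
    unfolding cross_cov_def using assms
    by (simp add: sq_integrable_integrable outer_def algebra_simps)
  also have "\<dots> = cross_cov M u w z - cross_cov M u' w z"
    unfolding cross_cov_def using assms
    by (intro Bochner_Integration.integral_diff integrable_outer sq_integrable_centred)
  finally show ?thesis .
qed

lemma cross_cov_diff_right:
  fixes u :: "'a \<Rightarrow> 'b::{real_inner,banach,second_countable_topology}"
    and w w' :: "'a \<Rightarrow> 'c::{real_inner,banach,second_countable_topology}"
  assumes "sq_integrable M u" "sq_integrable M w" "sq_integrable M w'"
  shows "cross_cov M u (\<lambda>x. w x - w' x) z = cross_cov M u w z - cross_cov M u w' z"
proof -
  have "cross_cov M u (\<lambda>x. w x - w' x) z =
      (\<integral>x. outer (u x - expectation u) (w x - expectation w) z -
            outer (u x - expectation u) (w' x - expectation w') z \<partial>M)"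
    unfolding cross_cov_def using assms
    by (simp add: sq_integrable_integrable outer_def inner_diff_left algebra_simps)
  also have "\<dots> = cross_cov M u w z - cross_cov M u w' z"
    unfolding cross_cov_def using assms
    by (intro Bochner_Integration.integral_diff integrable_outer sq_integrable_centred)
  finally show ?thesis .
qed

lemma cross_cov_blinfun_left:
  fixes u :: "'a \<Rightarrow> 'b::{real_inner,banach,second_countable_topology}"
    and w :: "'a \<Rightarrow> 'c::{real_inner,banach,second_countable_topology}"
    and F :: "'b \<Rightarrow>\<^sub>L 'd::{real_inner,banach,second_countable_topology}"
  assumes "sq_integrable M u" "sq_integrable M w"
  shows "cross_cov M (\<lambda>x. F (u x)) w z = F (cross_cov M u w z)"
proof -
  have F: "bounded_linear F" by (rule blinfun.bounded_linear_right)
  have "cross_cov M (\<lambda>x. F (u x)) w z =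
      (\<integral>x. F (outer (u x - expectation u) (w x - expectation w) z) \<partial>M)"
    unfolding cross_cov_def
    by (simp add: integral_bounded_linear[OF F sq_integrable_integrable[OF assms(1)]]
        outer_def blinfun.scaleR_right blinfun.diff_right)
  also have "\<dots> = F (cross_cov M u w z)"
    unfolding cross_cov_def using assms
    by (intro integral_bounded_linear[OF F] integrable_outer sq_integrable_centred)
  finally show ?thesis .
qed

lemma cross_cov_blinfun_right:
  fixes u :: "'a \<Rightarrow> 'b::{real_inner,banach,second_countable_topology}"
    and w :: "'a \<Rightarrow> 'c::{real_inner,banach,second_countable_topology}"
    and F :: "'c \<Rightarrow>\<^sub>L 'd::{real_inner,banach,second_countable_topology}"
  assumes "sq_integrable M w"
  shows "cross_cov M u (\<lambda>x. F (w x)) y = cross_cov M u w (adjoint F y)"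
proof -
  have F: "bounded_linear F" by (rule blinfun.bounded_linear_right)
  show ?thesis
    unfolding cross_cov_def outer_def integral_bounded_linear[OF F sq_integrable_integrable[OF assms]]
      blinfun.diff_right[symmetric] bounded_linear_adjoint_works[OF F] ..
qed

lemma adjoint_cross_cov:
  fixes u :: "'a \<Rightarrow> 'b::{real_inner,banach,second_countable_topology}"
    and w :: "'a \<Rightarrow> 'c::{real_inner,banach,second_countable_topology}"
  assumes "sq_integrable M u" "sq_integrable M w"
  shows "adjoint (cross_cov M u w) = cross_cov M w u"
proof (rule adjoint_unique, intro allI)
  fix z y
  let ?u = "\<lambda>x. u x - expectation u" and ?w = "\<lambda>x. w x - expectation w"
  have sq: "sq_integrable M ?u" "sq_integrable M ?w"
    using assms by (auto intro: sq_integrable_centred)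
  have "inner (cross_cov M u w z) y = (\<integral>x. inner (outer (?u x) (?w x) z) y \<partial>M)"
    unfolding cross_cov_def
    by (rule integral_inner_left[symmetric]) (use integrable_outer[OF sq] in simp)
  also have "\<dots> = (\<integral>x. inner z (outer (?w x) (?u x) y) \<partial>M)"
    by (simp add: outer_def inner_commute mult.commute)
  also have "\<dots> = inner z (cross_cov M w u y)"
    unfolding cross_cov_def
    by (rule integral_inner_right) (use integrable_outer[OF sq(2,1)] in simp)
  finally show "inner (cross_cov M u w z) y = inner z (cross_cov M w u y)" .
qed

end

section \<open>Invariance of the corrected surrogate and of the error covariance\<close>

text \<open>
  The parameter \<open>T\<close> is \<open>C\<^sub>G\<^sub>v C\<^sup>-\<^sup>1\<close>, the common value of \<open>F + C\<^sub>\<epsilon>\<^sub>v C\<^sup>-\<^sup>1\<close> over all surrogates \<open>F\<close>.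
\<close>
locale linear_error_correction = prob_space \<mu>
  for \<mu> :: "'h::{real_inner,banach,second_countable_topology} measure" +
  fixes G :: "'h \<Rightarrow> real ^ 'd::finite"
    and T :: "'h \<Rightarrow>\<^sub>L (real ^ 'd)"
  assumes sq_id: "sq_integrable \<mu> (\<lambda>x. x)"
    and sq_G: "sq_integrable \<mu> G"
    and cov_bounded: "bounded_linear (prior_cov \<mu>)"
    and cov_positive: "strictly_positive (prior_cov \<mu>)"
    and T_extends: "extends_comp_inv T (cross_cov \<mu> G (\<lambda>x. x)) (prior_cov \<mu>)"
begin

lemma inv_prior_cov: "inv_into UNIV (prior_cov \<mu>) (prior_cov \<mu> x) = x"
  by (intro inv_into_f_f strictly_positive_inj cov_bounded cov_positive) simp

lemma T_prior_cov: "T (prior_cov \<mu> x) = cross_cov \<mu> G (\<lambda>x. x) x"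
  using T_extends by (simp add: extends_comp_inv_def inv_prior_cov)

lemma sq_blinfun: "sq_integrable \<mu> (blinfun_apply F)"
  using sq_integrable_blinfun[OF sq_id] .

lemma sq_error: "sq_integrable \<mu> (approx_error G F)"
  unfolding approx_error_def by (intro sq_integrable_diff sq_G sq_blinfun)

lemma error_param_cov_eq:
  "error_param_cov \<mu> G F z = cross_cov \<mu> G (\<lambda>x. x) z - F (prior_cov \<mu> z)"
  unfolding error_param_cov_def approx_error_def prior_cov_def
  using cross_cov_diff_left[OF sq_G sq_blinfun sq_id] cross_cov_blinfun_left[OF sq_id sq_id]
  by simp

lemma comp_inv_error_param_cov: "comp_inv (error_param_cov \<mu> G F) (prior_cov \<mu>) = T - F"
  by (intro comp_inv_eqI cov_positive)
     (auto simp: extends_comp_inv_def inv_prior_cov error_param_cov_eq blinfun.diff_left T_prior_cov)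

lemma corrected_surrogate_eq: "corrected_surrogate \<mu> G F = T"
  by (simp add: corrected_surrogate_def comp_inv_error_param_cov)

lemma adjoint_error_param_cov_eq:
  "adjoint (error_param_cov \<mu> G F) y
     = cross_cov \<mu> (\<lambda>x. x) G y - prior_cov \<mu> (adjoint F y)"
  unfolding error_param_cov_def adjoint_cross_cov[OF sq_error sq_id]
  unfolding approx_error_def prior_cov_def
  using cross_cov_diff_right[OF sq_id sq_G sq_blinfun] cross_cov_blinfun_right[OF sq_id]
  by simp

lemma error_cov_eq:
  "error_cov \<mu> G F y = cross_cov \<mu> G G y - F (cross_cov \<mu> (\<lambda>x. x) G y)
     - cross_cov \<mu> G (\<lambda>x. x) (adjoint F y) + F (prior_cov \<mu> (adjoint F y))"
proof -
  have "error_cov \<mu> G F y = cross_cov \<mu> G (approx_error G F) y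
      - F (cross_cov \<mu> (\<lambda>x. x) (approx_error G F) y)"
    unfolding error_cov_def
    using cross_cov_diff_left[OF sq_G sq_blinfun sq_error]
      cross_cov_blinfun_left[OF sq_id sq_error]
    by (simp add: approx_error_def[abs_def])
  also have "cross_cov \<mu> G (approx_error G F) y
      = cross_cov \<mu> G G y - cross_cov \<mu> G (\<lambda>x. x) (adjoint F y)"
    unfolding approx_error_def
    using cross_cov_diff_right[OF sq_G sq_G sq_blinfun] cross_cov_blinfun_right[OF sq_id] by simp
  also have "cross_cov \<mu> (\<lambda>x. x) (approx_error G F) y
      = cross_cov \<mu> (\<lambda>x. x) G y - prior_cov \<mu> (adjoint F y)"
    unfolding approx_error_def prior_cov_def
    using cross_cov_diff_right[OF sq_id sq_G sq_blinfun] cross_cov_blinfun_right[OF sq_id] by simp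
  finally show ?thesis by (simp add: blinfun.diff_right)
qed

text \<open>
  The terms beyond \<open>\<Gamma>\<^sub>e\<close> form the covariance of the residual \<open>G v - T v\<close>, because
  \<open>T C T\<^sup>* = C\<^sub>G\<^sub>v T\<^sup>*\<close>. The mixed terms \<open>C\<^sub>G\<^sub>v F\<^sup>*\<close> and \<open>T C F\<^sup>*\<close> cancel by \<open>T_prior_cov\<close>.
\<close>
lemma total_error_cov_eq:
  "total_error_cov \<mu> G \<Gamma>\<^sub>e F y
     = \<Gamma>\<^sub>e *v y + cross_cov \<mu> G G y - T (cross_cov \<mu> (\<lambda>x. x) G y)"
  by (simp add: total_error_cov_def comp_inv_error_param_cov error_cov_eq
      adjoint_error_param_cov_eq blinfun.diff_left blinfun.diff_right T_prior_cov)

lemma posterior_cov_surrogate_independent: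
  "posterior_cov \<mu> G \<Gamma>\<^sub>e num \<tau> s F\<^sub>1 = posterior_cov \<mu> G \<Gamma>\<^sub>e num \<tau> s F\<^sub>2"
proof -
  have "total_error_cov \<mu> G \<Gamma>\<^sub>e F\<^sub>1 = total_error_cov \<mu> G \<Gamma>\<^sub>e F\<^sub>2"
    by (simp add: fun_eq_iff total_error_cov_eq)
  then show ?thesis
    by (simp add: posterior_cov_def[abs_def] corrected_surrogate_eq)
qed

end

section \<open>Independence of the optimal designs from the surrogate\<close>

theorem mainTheorem2:
  fixes P :: "'w measure"
    and v :: "'w \<Rightarrow> 'm::{real_inner,banach,second_countable_topology} \<times>
                   'x::{real_inner,banach,second_countable_topology}"
    and e :: "'w \<Rightarrow> real ^ 'd::finite"
    and \<mu> :: "('m \<times> 'x) measure"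
    and G :: "'m \<times> 'x \<Rightarrow> real ^ 'd"
    and e\<^sub>0 :: "real ^ 'd"
    and \<Gamma>\<^sub>e :: "real ^ 'd ^ 'd"
    and num :: "nat \<Rightarrow> 'd"
    and \<tau> s k :: nat
  assumes "prob_space P"
    and "v \<in> borel_measurable P" and "e \<in> borel_measurable P"
    and indep: "prob_space.indep_set P
        {v -` A \<inter> space P | A. A \<in> sets borel} {e -` A \<inter> space P | A. A \<in> sets borel}"
    and prior: "distr P borel v = \<mu>"
    and prior_moment: "integrable \<mu> (\<lambda>x. (norm x)\<^sup>2)"
    and prior_cov: "self_adjoint (prior_cov \<mu>)" "strictly_positive (prior_cov \<mu>)"
        "trace_class_pos (prior_cov \<mu>)"
    and noise: "is_gaussian (distr P borel e) e\<^sub>0 ((*v) \<Gamma>\<^sub>e)"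
        "transpose \<Gamma>\<^sub>e = \<Gamma>\<^sub>e" "\<forall>y. y \<noteq> 0 \<longrightarrow> 0 < inner (\<Gamma>\<^sub>e *v y) y"
    and G_bounded: "\<forall>S. bounded S \<longrightarrow> bounded (G ` S)"
    and G_moment: "G \<in> borel_measurable borel" "integrable \<mu> (\<lambda>x. (norm (G x))\<^sup>2)"
    and data_dim: "bij_betw num {..<\<tau> * s} UNIV"
    and corrected_bounded:
        "\<forall>F. \<exists>T. extends_comp_inv T (error_param_cov \<mu> G F) (prior_cov \<mu>)"
  shows "(\<forall>F\<^sub>1 F\<^sub>2. optimal_designs \<mu> G \<Gamma>\<^sub>e num \<tau> s k F\<^sub>1 = optimal_designs \<mu> G \<Gamma>\<^sub>e num \<tau> s k F\<^sub>2) \<and>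
         (\<forall>F. optimal_designs \<mu> G \<Gamma>\<^sub>e num \<tau> s k 0 = optimal_designs \<mu> G \<Gamma>\<^sub>e num \<tau> s k F)"
proof -
  interpret P: prob_space P by fact
  have "prob_space \<mu>"
    unfolding prior[symmetric] by (rule P.prob_space_distr) fact
  have sets: "sets \<mu> = sets borel" unfolding prior[symmetric] by simp
  \<comment> \<open>For the zero surrogate the approximation error is \<open>G\<close> itself.\<close>
  obtain T where "extends_comp_inv T (error_param_cov \<mu> G 0) (prior_cov \<mu>)"
    using corrected_bounded by blast
  then have T: "extends_comp_inv T (cross_cov \<mu> G (\<lambda>x. x)) (prior_cov \<mu>)"
    by (simp add: error_param_cov_def approx_error_def)
  interpret linear_error_correction \<mu> G T
  proof (intro linear_error_correction.intro linear_error_correction_axioms.intro)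
    show "bounded_linear (prior_cov \<mu>)" using prior_cov(3) by (simp add: trace_class_pos_def)
    show "sq_integrable \<mu> (\<lambda>x. x)"
      using prior_moment by (simp add: sq_integrable_def measurable_cong_sets[OF sets refl])
    show "sq_integrable \<mu> G"
      using G_moment by (simp add: sq_integrable_def measurable_cong_sets[OF sets refl])
  qed (fact \<open>prob_space \<mu>\<close> prior_cov(2) T)+
  have "optimal_designs \<mu> G \<Gamma>\<^sub>e num \<tau> s k F\<^sub>1 = optimal_designs \<mu> G \<Gamma>\<^sub>e num \<tau> s k F\<^sub>2"
    for F\<^sub>1 F\<^sub>2
    using posterior_cov_surrogate_independent[of \<Gamma>\<^sub>e num \<tau> s F\<^sub>1 F\<^sub>2]
    by (simp add: optimal_designs_def marginal_cov_def)
  then show ?thesis by blast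
qed

end
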